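(* Consider the linear model $Y=X\beta+\varepsilon$, where $X\in\mathbb{R}^{n\times p}$ is a fixed matrix with $X^\top X$ invertible and such that $Q\odot Q$ is invertible, with $Q=I_n-X(X^\top X)^{-1}X^\top$, and $\beta\in\mathbb{R}^p$. Let $S=(X^\top X)^{-1}X^\top$, let $\hat\beta=SY$ be the ordinary least-squares estimator, let $\hat\varepsilon=Y-X\hat\beta$ be the residual vector, let $\hat V=(S\odot S)(Q\odot Q)^{-1}(\hat\varepsilon\odot\hat\varepsilon)\in\mathbb{R}^p$, and let $V_j=\mathrm{Var}(\hat\beta_j)$ for $j=1,\dots,p$. If the noise $\varepsilon$ has i.i.d. normal entries with mean zero and variance $\sigma^2>0$, then the vector $d=(d_1,\dots,d_p)^\top$ of degrees of freedom of $\hat V$, defined by $$d_j=\frac{2}{\frac{\mathbb{E}\hat V_j^2}{V_j^2}-1}=\frac{2V_j^2}{\mathbb{E}\hat V_j^2-V_j^2},\qquad j=1,\dots,p,$$ has the form $$d=\frac{2E}{\mathrm{diag}\left[(S\odot S)1_n1_n^\top(S\odot S)^\top\right]+2\,\mathrm{diag}\left[(S\odot S)(Q\odot Q)^{-1}(S\odot S)^\top\right]-E},$$ where $E=\mathrm{diag}\left[(X^\top X)^{-1}\right]\odot\mathrm{diag}\left[(X^\top X)^{-1}\right]$ and the division is entrywise.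
   Context: $M\odot M$ denotes the Hadamard (entrywise) product of a matrix or vector with itself. $\mathrm{diag}[M]$ of a square matrix $M$ is the vector of its diagonal entries. $1_n$ is the column vector in $\mathbb{R}^n$ with all entries equal to one. $I_n$ is the identity matrix. *)

theory Defs
  imports "HOL-Probability.Probability"
begin

text \<open>Multiplication on the type of finite Cartesian vectors is componentwise in the library, and a
  matrix is a vector of rows; so \<open>*\<close> is the Hadamard product for both (the matrix product is \<open>**\<close>).\<close>

abbreviation hadamard :: "('a::times)^'k \<Rightarrow> 'a^'k \<Rightarrow> 'a^'k"  (infixl "\<odot>" 70)
  where "A \<odot> B \<equiv> A * B"

definition entrywise_div :: "real^'k \<Rightarrow> real^'k \<Rightarrow> real^'k"  (infixl "\<oslash>" 70)
  where "u \<oslash> v = (\<chi> i. u $ i / v $ i)"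

definition diag :: "real^'k^'k \<Rightarrow> real^'k"
  where "diag A = (\<chi> i. A $ i $ i)"

definition ones_col :: "real^1^'n"
  where "ones_col = (\<chi> i j. 1)"

text \<open>A matrix of type \<open>real^'p^'n\<close> has \<open>n\<close> rows and \<open>p\<close> columns.\<close>

definition S_mat :: "real^'p^'n \<Rightarrow> real^'n^'p"
  where "S_mat X = matrix_inv (transpose X ** X) ** transpose X"

definition Q_mat :: "real^'p^'n \<Rightarrow> real^'n^'n"
  where "Q_mat X = mat 1 - X ** matrix_inv (transpose X ** X) ** transpose X"

definition E_vec :: "real^'p^'n \<Rightarrow> real^'p"
  where "E_vec X = diag (matrix_inv (transpose X ** X)) \<odot> diag (matrix_inv (transpose X ** X))"

definition ols :: "real^'p^'n \<Rightarrow> real^'n \<Rightarrow> real^'p"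
  where "ols X y = S_mat X *v y"

definition resid :: "real^'p^'n \<Rightarrow> real^'n \<Rightarrow> real^'n"
  where "resid X y = y - X *v ols X y"

definition V_hat :: "real^'p^'n \<Rightarrow> real^'n \<Rightarrow> real^'p"
  where "V_hat X y =
    ((S_mat X \<odot> S_mat X) ** matrix_inv (Q_mat X \<odot> Q_mat X)) *v (resid X y \<odot> resid X y)"

text \<open>Degrees of freedom of a random variable \<open>W\<close> serving as an estimator of the number \<open>v\<close>.\<close>

definition dof :: "'a measure \<Rightarrow> ('a \<Rightarrow> real) \<Rightarrow> real \<Rightarrow> real"
  where "dof M W v = 2 / (prob_space.expectation M (\<lambda>\<omega>. (W \<omega>)\<^sup>2) / v\<^sup>2 - 1)"

end

theory Submission
  imports Defs
begin

text \<open>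
  Everything reduces to the second moment of a Gaussian quadratic form.  Fix \<open>j\<close>, write
  \<open>a\<^sub>i = S\<^sub>j\<^sub>i\<^sup>2\<close>, and let \<open>w\<close> be row \<open>j\<close> of \<open>(S \<odot> S) (Q \<odot> Q)\<inverse>\<close>, so that \<open>w (Q \<odot> Q) = a\<close>.
  Since \<open>Q X = 0\<close>, the residual is \<open>Q \<epsilon>\<close>, hence the \<open>j\<close>-th entry of the variance estimator is the
  quadratic form \<open>\<epsilon>\<^sup>T C \<epsilon>\<close> with \<open>C = Q diag(w) Q\<close>.  For independent centred normal entries with
  variance \<open>s\<close>, the mixed fourth moments (Isserlis) give
  \<open>E (\<epsilon>\<^sup>T C \<epsilon>)\<^sup>2 = s\<^sup>2 ((tr C)\<^sup>2 + 2 \<parallel>C\<parallel>\<^sup>2)\<close> with the Frobenius norm.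

  As \<open>Q\<close> is an orthogonal projection, three identities for \<open>C\<close> suffice.  Its diagonal is
  \<open>C\<^sub>k\<^sub>k = (w (Q \<odot> Q))\<^sub>k = a\<^sub>k\<close>.  Hence its trace is \<open>\<Sum>a = (S S\<^sup>T)\<^sub>j\<^sub>j = ((X\<^sup>T X)\<inverse>)\<^sub>j\<^sub>j\<close>, which is also
  \<open>V\<^sub>j / s\<close>.  Finally \<open>\<parallel>C\<parallel>\<^sup>2 = w (Q \<odot> Q) w\<^sup>T = w \<sqdot> a\<close>, which is the diagonal entry of
  \<open>(S \<odot> S) (Q \<odot> Q)\<inverse> (S \<odot> S)\<^sup>T\<close>.  Substituting these into the definition of the degrees of
  freedom gives the formula.

  No denominator vanishes: row \<open>j\<close> of \<open>S\<close> is nonzero because \<open>S X = I\<close>, so \<open>\<Sum>a > 0\<close>; and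
  \<open>\<parallel>C\<parallel>\<^sup>2 \<ge> \<Sum>\<^sub>k C\<^sub>k\<^sub>k\<^sup>2 = \<Sum>\<^sub>k a\<^sub>k\<^sup>2 > 0\<close>, so the estimator has positive variance.
\<close>

section \<open>Moments of independent centred normal variables\<close>

lemma (in prob_space) normal_power_moments:
  fixes Z :: "'a \<Rightarrow> real"
  assumes \<sigma>: "\<sigma> > 0" and Z: "distributed M lborel Z (normal_density 0 \<sigma>)"
  shows "integrable M (\<lambda>\<omega>. Z \<omega> ^ k)"
    and "expectation (\<lambda>\<omega>. Z \<omega> ^ (2 * k)) = fact (2 * k) / ((2 / \<sigma>\<^sup>2) ^ k * fact k)"
    and "expectation (\<lambda>\<omega>. Z \<omega> ^ (2 * k + 1)) = 0"
proof -
  have "integrable lborel (\<lambda>x. normal_density 0 \<sigma> x * x ^ k)"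
    using integrable_normal_moment[OF \<sigma>, of 0 k] by simp
  then show "integrable M (\<lambda>\<omega>. Z \<omega> ^ k)"
    by (subst (asm) distributed_integrable[OF Z]) auto
  show "expectation (\<lambda>\<omega>. Z \<omega> ^ (2 * k)) = fact (2 * k) / ((2 / \<sigma>\<^sup>2) ^ k * fact k)"
    using integral_normal_moment_even[OF \<sigma>, of 0 k]
    by (subst distributed_integral[OF Z, symmetric]) auto
  show "expectation (\<lambda>\<omega>. Z \<omega> ^ (2 * k + 1)) = 0"
    using integral_normal_moment_odd[OF \<sigma>, of 0 k]
    by (subst distributed_integral[OF Z, symmetric]) auto
qed

lemma (in prob_space) indep_monomial:
  fixes Z :: "'n::finite \<Rightarrow> 'a \<Rightarrow> real"
  assumes ind: "indep_vars (\<lambda>_. borel) Z UNIV"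
    and int: "\<And>i k. integrable M (\<lambda>\<omega>. Z i \<omega> ^ k)"
  shows "integrable M (\<lambda>\<omega>. \<Prod>i\<in>UNIV. Z i \<omega> ^ m i)"
    and "expectation (\<lambda>\<omega>. \<Prod>i\<in>UNIV. Z i \<omega> ^ m i) = (\<Prod>i\<in>UNIV. expectation (\<lambda>\<omega>. Z i \<omega> ^ m i))"
proof -
  have *: "indep_vars (\<lambda>_. borel) (\<lambda>i \<omega>. Z i \<omega> ^ m i) UNIV"
    by (rule indep_vars_compose2[OF ind]) auto
  show "integrable M (\<lambda>\<omega>. \<Prod>i\<in>UNIV. Z i \<omega> ^ m i)"
    using * int by (intro indep_vars_integrable) auto
  show "expectation (\<lambda>\<omega>. \<Prod>i\<in>UNIV. Z i \<omega> ^ m i) = (\<Prod>i\<in>UNIV. expectation (\<lambda>\<omega>. Z i \<omega> ^ m i))"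
    using * int by (intro indep_vars_lebesgue_integral) auto
qed

lemma prod_power_of_bool:
  fixes f :: "'n::finite \<Rightarrow> real"
  shows "(\<Prod>x\<in>UNIV. f x ^ of_bool (x = i)) = f i"
proof -
  have "(\<Prod>x\<in>UNIV. f x ^ of_bool (x = i)) = (\<Prod>x\<in>UNIV. if x = i then f x else 1)"
    by (intro prod.cong) auto
  then show ?thesis by simp
qed

text \<open>Both products run over multiplicities: the exponent of \<open>x\<close> counts how often \<open>x\<close> occurs among
  the given indices, and \<open>g\<close> sends a multiplicity to the corresponding univariate moment.\<close>

lemma prod_moments_two:
  fixes g :: "nat \<Rightarrow> real" and i k :: "'n::finite"
  assumes g: "g 0 = 1" "g 1 = 0" "g 2 = s"
  shows "(\<Prod>x\<in>UNIV. g (of_bool (x = i) + of_bool (x = k))) = s * of_bool (i = k)"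
proof -
  have "(\<Prod>x\<in>UNIV. g (of_bool (x = i) + of_bool (x = k)))
      = (\<Prod>x\<in>{i,k}. g (of_bool (x = i) + of_bool (x = k)))"
    by (rule prod.mono_neutral_right) (auto simp: g)
  also have "\<dots> = s * of_bool (i = k)"
    by (cases "i = k") (use g in \<open>auto simp: numeral_2_eq_2\<close>)
  finally show ?thesis .
qed

lemma prod_moments_four:
  fixes g :: "nat \<Rightarrow> real" and i k l m :: "'n::finite"
  assumes g: "g 0 = 1" "g 1 = 0" "g 2 = s" "g 3 = 0" "g 4 = 3 * s\<^sup>2"
  shows "(\<Prod>x\<in>UNIV. g (of_bool (x = i) + of_bool (x = k) + of_bool (x = l) + of_bool (x = m)))
    = s\<^sup>2 * (of_bool (i = k \<and> l = m) + of_bool (i = l \<and> k = m) + of_bool (i = m \<and> k = l))"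
proof -
  have "(\<Prod>x\<in>UNIV. g (of_bool (x = i) + of_bool (x = k) + of_bool (x = l) + of_bool (x = m)))
      = (\<Prod>x\<in>{i,k,l,m}. g (of_bool (x = i) + of_bool (x = k) + of_bool (x = l) + of_bool (x = m)))"
    by (rule prod.mono_neutral_right) (auto simp: g)
  also have "\<dots> = s\<^sup>2 * (of_bool (i = k \<and> l = m) + of_bool (i = l \<and> k = m) + of_bool (i = m \<and> k = l))"
    by (cases "i = k"; cases "i = l"; cases "i = m"; cases "k = l"; cases "k = m"; cases "l = m";
        insert g; simp add: power2_eq_square eval_nat_numeral insert_commute)
  finally show ?thesis .
qed

text \<open>Grouping equal factors turns a mixed moment into a product of univariate moments, so only
  index tuples that split into equal pairs survive.\<close>

lemma (in prob_space) gaussian_mixed_moments: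
  fixes Z :: "'n::finite \<Rightarrow> 'a \<Rightarrow> real"
  assumes \<sigma>: "\<sigma> > 0"
    and ind: "indep_vars (\<lambda>_. borel) Z UNIV"
    and Z: "\<And>i. distributed M lborel (Z i) (normal_density 0 \<sigma>)"
  shows "integrable M (\<lambda>\<omega>. Z i \<omega> * Z k \<omega>)"
    and "expectation (\<lambda>\<omega>. Z i \<omega> * Z k \<omega>) = \<sigma>\<^sup>2 * of_bool (i = k)"
    and "integrable M (\<lambda>\<omega>. Z i \<omega> * Z k \<omega> * Z l \<omega> * Z m \<omega>)"
    and "expectation (\<lambda>\<omega>. Z i \<omega> * Z k \<omega> * Z l \<omega> * Z m \<omega>) =
      (\<sigma>\<^sup>2)\<^sup>2 * (of_bool (i = k \<and> l = m) + of_bool (i = l \<and> k = m) + of_bool (i = m \<and> k = l))"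
proof -
  note int = normal_power_moments(1)[OF \<sigma> Z]
  note even = normal_power_moments(2)[OF \<sigma> Z]
  note odd = normal_power_moments(3)[OF \<sigma> Z]
  \<comment> \<open>The variables are identically distributed, so any index serves to define the moments.\<close>
  define g where "g = (\<lambda>k. expectation (\<lambda>\<omega>. Z undefined \<omega> ^ k))"
  have g_eq: "expectation (\<lambda>\<omega>. Z i \<omega> ^ k) = g k" for i k
    unfolding g_def using even[of _ "k div 2"] odd[of _ "k div 2"]
    by (cases "even k") auto
  have g: "g 0 = 1" "g 1 = 0" "g 2 = \<sigma>\<^sup>2" "g 3 = 0" "g 4 = 3 * (\<sigma>\<^sup>2)\<^sup>2"
    unfolding g_def using even[of _ 0] odd[of _ 0] even[of _ 1] odd[of _ 1] even[of _ 2] \<sigma>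
    by (simp_all add: fact_numeral power_divide prob_space)
  have two: "Z i \<omega> * Z k \<omega> = (\<Prod>x\<in>UNIV. Z x \<omega> ^ (of_bool (x = i) + of_bool (x = k)))" for \<omega>
    by (simp only: power_add prod.distrib prod_power_of_bool)
  have four: "Z i \<omega> * Z k \<omega> * Z l \<omega> * Z m \<omega> = (\<Prod>x\<in>UNIV. Z x \<omega> ^
      (of_bool (x = i) + of_bool (x = k) + of_bool (x = l) + of_bool (x = m)))" for \<omega>
    by (simp only: power_add prod.distrib prod_power_of_bool)
  show "integrable M (\<lambda>\<omega>. Z i \<omega> * Z k \<omega>)"
    unfolding two by (rule indep_monomial(1)[OF ind int])
  show "expectation (\<lambda>\<omega>. Z i \<omega> * Z k \<omega>) = \<sigma>\<^sup>2 * of_bool (i = k)"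
    unfolding two indep_monomial(2)[OF ind int] g_eq by (rule prod_moments_two[OF g(1-3)])
  show "integrable M (\<lambda>\<omega>. Z i \<omega> * Z k \<omega> * Z l \<omega> * Z m \<omega>)"
    unfolding four by (rule indep_monomial(1)[OF ind int])
  show "expectation (\<lambda>\<omega>. Z i \<omega> * Z k \<omega> * Z l \<omega> * Z m \<omega>) =
      (\<sigma>\<^sup>2)\<^sup>2 * (of_bool (i = k \<and> l = m) + of_bool (i = l \<and> k = m) + of_bool (i = m \<and> k = l))"
    unfolding four indep_monomial(2)[OF ind int] g_eq by (rule prod_moments_four[OF g])
qed

section \<open>Gaussian quadratic forms\<close>

definition quad_form :: "('n::finite \<Rightarrow> 'n \<Rightarrow> real) \<Rightarrow> ('n \<Rightarrow> real) \<Rightarrow> real" where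
  "quad_form C z = (\<Sum>i\<in>UNIV. \<Sum>k\<in>UNIV. C i k * (z i * z k))"

lemma quad_form_square:
  "(quad_form C z)\<^sup>2 =
    (\<Sum>i\<in>UNIV. \<Sum>k\<in>UNIV. \<Sum>l\<in>UNIV. \<Sum>m\<in>UNIV. C i k * C l m * (z i * z k * z l * z m))"
proof -
  have "(quad_form C z)\<^sup>2 =
      (\<Sum>i\<in>UNIV. \<Sum>l\<in>UNIV. \<Sum>k\<in>UNIV. \<Sum>m\<in>UNIV. C i k * C l m * (z i * z k * z l * z m))"
    unfolding quad_form_def power2_eq_square by (simp add: sum_product mult_ac)
  also have "\<dots> = (\<Sum>i\<in>UNIV. \<Sum>k\<in>UNIV. \<Sum>l\<in>UNIV. \<Sum>m\<in>UNIV. C i k * C l m * (z i * z k * z l * z m))"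
    by (intro sum.cong refl sum.swap)
  finally show ?thesis .
qed

lemma sum_pairings:
  fixes C :: "'n::finite \<Rightarrow> 'n \<Rightarrow> real"
  shows "(\<Sum>i\<in>UNIV. \<Sum>k\<in>UNIV. \<Sum>l\<in>UNIV. \<Sum>m\<in>UNIV. C i k * C l m *
      (of_bool (i = k \<and> l = m) + of_bool (i = l \<and> k = m) + of_bool (i = m \<and> k = l)))
    = (\<Sum>i\<in>UNIV. C i i)\<^sup>2 + (\<Sum>i\<in>UNIV. \<Sum>k\<in>UNIV. C i k * C i k) + (\<Sum>i\<in>UNIV. \<Sum>k\<in>UNIV. C i k * C k i)"
proof -
  have 1: "(\<Sum>l\<in>UNIV. \<Sum>m\<in>UNIV. C i k * C l m * of_bool (i = k \<and> l = m))
      = (if i = k then C i k * (\<Sum>l\<in>UNIV. C l l) else 0)" for i k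
    by (auto simp: of_bool_def sum_distrib_left if_distrib cong: if_cong)
  have 2: "(\<Sum>l\<in>UNIV. \<Sum>m\<in>UNIV. C i k * C l m * of_bool (i = l \<and> k = m)) = C i k * C i k" for i k
  proof -
    have "(\<Sum>l\<in>UNIV. \<Sum>m\<in>UNIV. C i k * C l m * of_bool (i = l \<and> k = m))
        = (\<Sum>l\<in>UNIV. if i = l then (\<Sum>m\<in>UNIV. if k = m then C i k * C l m else 0) else 0)"
      by (intro sum.cong refl) (auto intro!: sum.cong)
    then show ?thesis by simp
  qed
  have 3: "(\<Sum>l\<in>UNIV. \<Sum>m\<in>UNIV. C i k * C l m * of_bool (i = m \<and> k = l)) = C i k * C k i" for i k
  proof -
    have "(\<Sum>l\<in>UNIV. \<Sum>m\<in>UNIV. C i k * C l m * of_bool (i = m \<and> k = l))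
        = (\<Sum>l\<in>UNIV. if k = l then (\<Sum>m\<in>UNIV. if i = m then C i k * C l m else 0) else 0)"
      by (intro sum.cong refl) (auto intro!: sum.cong)
    then show ?thesis by simp
  qed
  show ?thesis
    unfolding distrib_left sum.distrib 1 2 3 by (simp add: power2_eq_square sum_distrib_right)
qed

text \<open>The three pairings of a fourth moment contribute \<open>(tr C)\<^sup>2\<close>, \<open>\<parallel>C\<parallel>\<^sup>2\<close> and \<open>tr (C C)\<close>; symmetry
  of \<open>C\<close> makes the last two equal.\<close>

lemma (in prob_space) gaussian_quad_form:
  fixes Z :: "'n::finite \<Rightarrow> 'a \<Rightarrow> real"
  assumes \<sigma>: "\<sigma> > 0"
    and ind: "indep_vars (\<lambda>_. borel) Z UNIV"
    and Z: "\<And>i. distributed M lborel (Z i) (normal_density 0 \<sigma>)"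
  shows "expectation (\<lambda>\<omega>. quad_form C (\<lambda>i. Z i \<omega>)) = \<sigma>\<^sup>2 * (\<Sum>i\<in>UNIV. C i i)"
    and "integrable M (\<lambda>\<omega>. (quad_form C (\<lambda>i. Z i \<omega>))\<^sup>2)"
    and "(\<And>i k. C i k = C k i) \<Longrightarrow> expectation (\<lambda>\<omega>. (quad_form C (\<lambda>i. Z i \<omega>))\<^sup>2)
      = (\<sigma>\<^sup>2)\<^sup>2 * ((\<Sum>i\<in>UNIV. C i i)\<^sup>2 + 2 * (\<Sum>i\<in>UNIV. \<Sum>k\<in>UNIV. (C i k)\<^sup>2))"
proof -
  note mom = gaussian_mixed_moments[OF \<sigma> ind Z]
  show "expectation (\<lambda>\<omega>. quad_form C (\<lambda>i. Z i \<omega>)) = \<sigma>\<^sup>2 * (\<Sum>i\<in>UNIV. C i i)"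
    unfolding quad_form_def
    by (simp add: mom Bochner_Integration.integral_sum sum_distrib_left mult_ac if_distrib of_bool_def
        cong: if_cong)
  show "integrable M (\<lambda>\<omega>. (quad_form C (\<lambda>i. Z i \<omega>))\<^sup>2)"
    unfolding quad_form_square by (intro Bochner_Integration.integrable_sum integrable_mult_right mom)
  assume sym: "\<And>i k. C i k = C k i"
  have "expectation (\<lambda>\<omega>. (quad_form C (\<lambda>i. Z i \<omega>))\<^sup>2)
      = (\<Sum>i\<in>UNIV. \<Sum>k\<in>UNIV. \<Sum>l\<in>UNIV. \<Sum>m\<in>UNIV. C i k * C l m * ((\<sigma>\<^sup>2)\<^sup>2 *
      (of_bool (i = k \<and> l = m) + of_bool (i = l \<and> k = m) + of_bool (i = m \<and> k = l))))"
    unfolding quad_form_square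
    by (simp add: mom(3,4) Bochner_Integration.integral_sum Bochner_Integration.integrable_sum del: of_bool_conj)
  also have "\<dots> = (\<sigma>\<^sup>2)\<^sup>2 * (\<Sum>i\<in>UNIV. \<Sum>k\<in>UNIV. \<Sum>l\<in>UNIV. \<Sum>m\<in>UNIV. C i k * C l m *
      (of_bool (i = k \<and> l = m) + of_bool (i = l \<and> k = m) + of_bool (i = m \<and> k = l)))"
    unfolding sum_distrib_left by (simp only: mult_ac)
  also have "\<dots> = (\<sigma>\<^sup>2)\<^sup>2 * ((\<Sum>i\<in>UNIV. C i i)\<^sup>2 + 2 * (\<Sum>i\<in>UNIV. \<Sum>k\<in>UNIV. (C i k)\<^sup>2))"
    unfolding sum_pairings using sym by (simp add: power2_eq_square)
  finally show "expectation (\<lambda>\<omega>. (quad_form C (\<lambda>i. Z i \<omega>))\<^sup>2)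
      = (\<sigma>\<^sup>2)\<^sup>2 * ((\<Sum>i\<in>UNIV. C i i)\<^sup>2 + 2 * (\<Sum>i\<in>UNIV. \<Sum>k\<in>UNIV. (C i k)\<^sup>2))" .
qed

section \<open>The least-squares matrices\<close>

lemma matrix_inv_inverse:
  fixes A :: "real^'n^'n"
  assumes "invertible A"
  shows "A ** matrix_inv A = mat 1" "matrix_inv A ** A = mat 1"
  using someI_ex[OF assms[unfolded invertible_def]] unfolding matrix_inv_def by auto

lemma transpose_matrix_inv_symmetric:
  fixes A :: "real^'n^'n"
  assumes inv: "invertible A" and sym: "transpose A = A"
  shows "transpose (matrix_inv A) = matrix_inv A"
proof -
  have "transpose (matrix_inv A) = transpose (matrix_inv A) ** (A ** matrix_inv A)"
    by (simp add: matrix_inv_inverse[OF inv])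
  also have "\<dots> = transpose (A ** matrix_inv A) ** matrix_inv A"
    by (simp add: matrix_transpose_mul sym matrix_mul_assoc)
  finally show ?thesis by (simp add: matrix_inv_inverse[OF inv] transpose_mat)
qed

context
  fixes X :: "real^'p^'n"
  assumes inv_gram: "invertible (transpose X ** X)"
begin

lemma transpose_gram_inv:
  "transpose (matrix_inv (transpose X ** X)) = matrix_inv (transpose X ** X)"
  by (rule transpose_matrix_inv_symmetric[OF inv_gram]) (simp add: matrix_transpose_mul)

lemma S_mat_mult_design: "S_mat X ** X = mat 1"
  unfolding S_mat_def using matrix_inv_inverse(2)[OF inv_gram] by (simp add: matrix_mul_assoc)

lemma S_mat_mult_transpose: "S_mat X ** transpose (S_mat X) = matrix_inv (transpose X ** X)"
proof -
  have "S_mat X ** transpose (S_mat X) = (S_mat X ** X) ** matrix_inv (transpose X ** X)"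
    by (simp add: S_mat_def matrix_transpose_mul transpose_gram_inv matrix_mul_assoc)
  then show ?thesis by (simp add: S_mat_mult_design)
qed

lemma Q_mat_eq: "Q_mat X = mat 1 - X ** S_mat X"
  by (simp add: Q_mat_def S_mat_def matrix_mul_assoc)

lemma transpose_Q_mat: "transpose (Q_mat X) = Q_mat X"
proof -
  have "transpose (X ** S_mat X) = X ** S_mat X"
    by (simp add: S_mat_def matrix_transpose_mul transpose_gram_inv matrix_mul_assoc)
  then show ?thesis
    unfolding Q_mat_eq by (simp add: transpose_def vec_eq_iff mat_def)
qed

lemma Q_mat_idem: "Q_mat X ** Q_mat X = Q_mat X"
proof -
  have "(X ** S_mat X) ** (X ** S_mat X) = X ** (S_mat X ** X) ** S_mat X"
    by (simp add: matrix_mul_assoc)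
  then have "(X ** S_mat X) ** (X ** S_mat X) = X ** S_mat X"
    by (simp add: S_mat_mult_design)
  then show ?thesis
    unfolding Q_mat_eq matrix_eq
    by (simp add: matrix_vector_mult_diff_rdistrib matrix_vector_mult_diff_distrib
        flip: matrix_vector_mul_assoc)
qed

lemma ols_model: "ols X (X *v b + e) = b + S_mat X *v e"
  by (simp add: ols_def matrix_vector_right_distrib matrix_vector_mul_assoc S_mat_mult_design)

lemma resid_model: "resid X (X *v b + e) = Q_mat X *v e"
  by (simp add: resid_def ols_model Q_mat_eq matrix_vector_right_distrib
      matrix_vector_mult_diff_rdistrib matrix_vector_mul_assoc)

lemma sum_S_mat_squares:
  "(\<Sum>i\<in>UNIV. (S_mat X $ j $ i)\<^sup>2) = matrix_inv (transpose X ** X) $ j $ j"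
  unfolding S_mat_mult_transpose[symmetric]
  by (simp add: matrix_matrix_mult_def transpose_def power2_eq_square)

lemma S_mat_row_nonzero: "\<exists>i. S_mat X $ j $ i \<noteq> 0"
proof (rule ccontr)
  assume "\<not> ?thesis"
  then have "(S_mat X ** X) $ j $ j = 0" by (simp add: matrix_matrix_mult_def)
  then show False by (simp add: S_mat_mult_design mat_def)
qed

lemma Q_mat_row_product: "(\<Sum>k\<in>UNIV. Q_mat X $ i $ k * Q_mat X $ m $ k) = Q_mat X $ i $ m"
proof -
  have "(\<Sum>k\<in>UNIV. Q_mat X $ i $ k * Q_mat X $ m $ k) = (Q_mat X ** transpose (Q_mat X)) $ i $ m"
    by (simp add: matrix_matrix_mult_def transpose_def)
  then show ?thesis by (simp add: transpose_Q_mat Q_mat_idem)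
qed

end

section \<open>The variance estimator as a quadratic form in the noise\<close>

definition vhat_weight :: "real^'p^'n \<Rightarrow> 'p \<Rightarrow> 'n \<Rightarrow> real" where
  "vhat_weight X j i = ((S_mat X \<odot> S_mat X) ** matrix_inv (Q_mat X \<odot> Q_mat X)) $ j $ i"

text \<open>The matrix \<open>Q diag(w) Q\<close>, where the first factor is replaced by its transpose.\<close>

definition vhat_form :: "real^'p^'n \<Rightarrow> 'p \<Rightarrow> 'n \<Rightarrow> 'n \<Rightarrow> real" where
  "vhat_form X j k l = (\<Sum>i\<in>UNIV. vhat_weight X j i * (Q_mat X $ i $ k * Q_mat X $ i $ l))"

lemma V_hat_quad_form:
  assumes "invertible (transpose X ** X)"
  shows "V_hat X (X *v b + e) $ j = quad_form (vhat_form X j) (\<lambda>i. e $ i)"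
proof -
  have "V_hat X (X *v b + e) $ j = (\<Sum>i\<in>UNIV. vhat_weight X j i *
      ((\<Sum>k\<in>UNIV. Q_mat X $ i $ k * e $ k) * (\<Sum>l\<in>UNIV. Q_mat X $ i $ l * e $ l)))"
    unfolding V_hat_def resid_model[OF assms] vhat_weight_def
    by (simp add: matrix_vector_mult_def)
  also have "\<dots> = (\<Sum>i\<in>UNIV. \<Sum>k\<in>UNIV. \<Sum>l\<in>UNIV.
      vhat_weight X j i * (Q_mat X $ i $ k * Q_mat X $ i $ l) * (e $ k * e $ l))"
    by (simp add: sum_product sum_distrib_left mult_ac)
  also have "\<dots> = (\<Sum>k\<in>UNIV. \<Sum>i\<in>UNIV. \<Sum>l\<in>UNIV.
      vhat_weight X j i * (Q_mat X $ i $ k * Q_mat X $ i $ l) * (e $ k * e $ l))"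
    by (rule sum.swap)
  also have "\<dots> = (\<Sum>k\<in>UNIV. \<Sum>l\<in>UNIV. \<Sum>i\<in>UNIV.
      vhat_weight X j i * (Q_mat X $ i $ k * Q_mat X $ i $ l) * (e $ k * e $ l))"
    by (intro sum.cong refl sum.swap)
  also have "\<dots> = quad_form (vhat_form X j) (\<lambda>i. e $ i)"
    by (simp add: quad_form_def vhat_form_def sum_distrib_right)
  finally show ?thesis .
qed

text \<open>The diagonal of \<open>Q\<^sup>T diag(w) Q\<close> is \<open>w (Q \<odot> Q)\<close>, and \<open>w\<close> solves exactly this linear system.\<close>

lemma vhat_form_diag:
  assumes "invertible (Q_mat X \<odot> Q_mat X)"
  shows "vhat_form X j k k = (S_mat X $ j $ k)\<^sup>2"
proof -
  have "vhat_form X j k k = (((S_mat X \<odot> S_mat X) ** matrix_inv (Q_mat X \<odot> Q_mat X))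
      ** (Q_mat X \<odot> Q_mat X)) $ j $ k"
    unfolding vhat_form_def vhat_weight_def
    by (subst (2) matrix_matrix_mult_def) simp
  also have "\<dots> = (S_mat X \<odot> S_mat X) $ j $ k"
    by (simp add: matrix_inv_inverse[OF assms] flip: matrix_mul_assoc)
  finally show ?thesis by (simp add: power2_eq_square)
qed

text \<open>This is \<open>tr (Q D Q Q D Q) = tr (D Q D Q) = w (Q \<odot> Q) w\<^sup>T\<close> for \<open>D = diag(w)\<close>, where
  idempotence of \<open>Q\<close> collapses the sums over both outer indices.\<close>

lemma vhat_form_frobenius:
  assumes gram: "invertible (transpose X ** X)" and QQ: "invertible (Q_mat X \<odot> Q_mat X)"
  shows "(\<Sum>k\<in>UNIV. \<Sum>l\<in>UNIV. (vhat_form X j k l)\<^sup>2) =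
    diag ((S_mat X \<odot> S_mat X) ** matrix_inv (Q_mat X \<odot> Q_mat X)
      ** transpose (S_mat X \<odot> S_mat X)) $ j"
proof -
  let ?Q = "\<lambda>i k. Q_mat X $ i $ k" and ?w = "vhat_weight X j"
  have Qprod: "(\<Sum>k\<in>UNIV. ?Q i k * ?Q m k) = ?Q i m" for i m
    by (rule Q_mat_row_product[OF gram])
  have "(\<Sum>k\<in>UNIV. \<Sum>l\<in>UNIV. (vhat_form X j k l)\<^sup>2) = (\<Sum>k\<in>UNIV. \<Sum>l\<in>UNIV. \<Sum>i\<in>UNIV. \<Sum>m\<in>UNIV.
      (?w i * ?w m) * ((?Q i k * ?Q m k) * (?Q i l * ?Q m l)))"
    by (simp add: vhat_form_def power2_eq_square sum_product mult_ac)
  also have "\<dots> = (\<Sum>k\<in>UNIV. \<Sum>i\<in>UNIV. \<Sum>l\<in>UNIV. \<Sum>m\<in>UNIV.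
      (?w i * ?w m) * ((?Q i k * ?Q m k) * (?Q i l * ?Q m l)))"
    by (intro sum.cong refl sum.swap)
  also have "\<dots> = (\<Sum>i\<in>UNIV. \<Sum>k\<in>UNIV. \<Sum>m\<in>UNIV. \<Sum>l\<in>UNIV.
      (?w i * ?w m) * ((?Q i k * ?Q m k) * (?Q i l * ?Q m l)))"
    by (subst sum.swap) (intro sum.cong refl sum.swap)
  also have "\<dots> = (\<Sum>i\<in>UNIV. \<Sum>m\<in>UNIV. \<Sum>k\<in>UNIV. \<Sum>l\<in>UNIV.
      (?w i * ?w m) * ((?Q i k * ?Q m k) * (?Q i l * ?Q m l)))"
    by (intro sum.cong refl sum.swap)
  also have "\<dots> = (\<Sum>i\<in>UNIV. \<Sum>m\<in>UNIV. (?w i * ?w m) * (?Q i m * ?Q i m))"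
    by (simp add: Qprod flip: sum_distrib_left sum_distrib_right)
  also have "\<dots> = (\<Sum>m\<in>UNIV. ?w m * vhat_form X j m m)"
    by (subst sum.swap) (simp add: vhat_form_def sum_distrib_left mult_ac)
  also have "\<dots> = (\<Sum>m\<in>UNIV. ?w m * (S_mat X $ j $ m)\<^sup>2)"
    by (simp only: vhat_form_diag[OF QQ])
  also have "\<dots> = diag ((S_mat X \<odot> S_mat X) ** matrix_inv (Q_mat X \<odot> Q_mat X)
      ** transpose (S_mat X \<odot> S_mat X)) $ j"
    unfolding diag_def vhat_weight_def
    by (subst (3) matrix_matrix_mult_def) (simp add: transpose_def power2_eq_square)
  finally show ?thesis .
qed

text \<open>The diagonal alone already makes the norm positive: its entries are the squares of a nonzero row
  of \<open>S\<close>.\<close>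

lemma vhat_form_frobenius_pos:
  assumes gram: "invertible (transpose X ** X)" and QQ: "invertible (Q_mat X \<odot> Q_mat X)"
  shows "(\<Sum>k\<in>UNIV. \<Sum>l\<in>UNIV. (vhat_form X j k l)\<^sup>2) > 0"
proof -
  obtain i where "S_mat X $ j $ i \<noteq> 0" using S_mat_row_nonzero[OF gram] by blast
  then have "0 < (vhat_form X j i i)\<^sup>2" by (simp add: vhat_form_diag[OF QQ])
  also have "\<dots> \<le> (\<Sum>l\<in>UNIV. (vhat_form X j i l)\<^sup>2)"
    by (rule member_le_sum) auto
  also have "\<dots> \<le> (\<Sum>k\<in>UNIV. \<Sum>l\<in>UNIV. (vhat_form X j k l)\<^sup>2)"
    by (rule member_le_sum[where f="\<lambda>k. \<Sum>l\<in>UNIV. (vhat_form X j k l)\<^sup>2"]) (auto intro: sum_nonneg)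
  finally show ?thesis .
qed

lemma diag_ones_col:
  fixes A :: "real^'n^'p"
  shows "diag (A ** ones_col ** transpose ones_col ** transpose A) $ j = (\<Sum>i\<in>UNIV. A $ j $ i)\<^sup>2"
  by (simp add: diag_def matrix_matrix_mult_def ones_col_def transpose_def power2_eq_square
      sum_distrib_left sum_distrib_right)

text \<open>The variance of an estimator entry is that of a linear form in the noise, whose square is the
  quadratic form with matrix \<open>S\<^sub>j\<^sup>T S\<^sub>j\<close>.\<close>

lemma (in prob_space) ols_variance:
  fixes X :: "real^'p^'n" and \<epsilon> :: "'a \<Rightarrow> real^'n"
  assumes gram: "invertible (transpose X ** X)" and \<sigma>: "\<sigma> > 0"
    and ind: "indep_vars (\<lambda>_. borel) (\<lambda>i \<omega>. \<epsilon> \<omega> $ i) UNIV"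
    and normal: "\<And>i. distributed M lborel (\<lambda>\<omega>. \<epsilon> \<omega> $ i) (normal_density 0 \<sigma>)"
  shows "variance (\<lambda>\<omega>. ols X (X *v b + \<epsilon> \<omega>) $ j) = \<sigma>\<^sup>2 * (\<Sum>i\<in>UNIV. (S_mat X $ j $ i)\<^sup>2)"
proof -
  have int: "integrable M (\<lambda>\<omega>. \<epsilon> \<omega> $ i)" for i
    using normal_power_moments(1)[OF \<sigma> normal, where k=1] by simp
  have mean0: "expectation (\<lambda>\<omega>. \<epsilon> \<omega> $ i) = 0" for i
    using normal_power_moments(3)[OF \<sigma> normal, where k=0] by simp
  have ols: "ols X (X *v b + \<epsilon> \<omega>) $ j = b $ j + (\<Sum>i\<in>UNIV. S_mat X $ j $ i * \<epsilon> \<omega> $ i)" for \<omega>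
    unfolding ols_model[OF gram] by (simp add: matrix_vector_mult_def)
  have mean: "expectation (\<lambda>\<omega>. ols X (X *v b + \<epsilon> \<omega>) $ j) = b $ j"
    unfolding ols by (simp add: int mean0 prob_space)
  have "variance (\<lambda>\<omega>. ols X (X *v b + \<epsilon> \<omega>) $ j)
      = expectation (\<lambda>\<omega>. quad_form (\<lambda>i k. S_mat X $ j $ i * S_mat X $ j $ k) (\<lambda>i. \<epsilon> \<omega> $ i))"
    unfolding mean unfolding ols
    by (simp add: quad_form_def power2_eq_square sum_product mult_ac)
  also have "\<dots> = \<sigma>\<^sup>2 * (\<Sum>i\<in>UNIV. (S_mat X $ j $ i)\<^sup>2)"
    by (simp add: gaussian_quad_form(1)[OF \<sigma> ind normal] power2_eq_square)
  finally show ?thesis .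
qed

section \<open>Degrees of freedom\<close>

theorem mainTheorem5:
  fixes M :: "'a measure" and X :: "real^'p^'n" and \<beta> :: "real^'p"
    and \<epsilon> Y :: "'a \<Rightarrow> real^'n" and \<sigma> :: real and V d :: "real^'p"
  assumes prob: "prob_space M"
    and inv_gram: "invertible (transpose X ** X)"
    and inv_QQ: "invertible (Q_mat X \<odot> Q_mat X)"
    and sigma_pos: "\<sigma> > 0"
    and noise_indep: "prob_space.indep_vars M (\<lambda>_. borel) (\<lambda>i \<omega>. \<epsilon> \<omega> $ i) UNIV"
    and noise_normal: "\<And>i. distributed M lborel (\<lambda>\<omega>. \<epsilon> \<omega> $ i) (normal_density 0 \<sigma>)"
    and model: "Y = (\<lambda>\<omega>. X *v \<beta> + \<epsilon> \<omega>)"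
    and V_def: "\<And>j. V $ j = prob_space.variance M (\<lambda>\<omega>. ols X (Y \<omega>) $ j)"
    and d_def: "\<And>j. d $ j = dof M (\<lambda>\<omega>. V_hat X (Y \<omega>) $ j) (V $ j)"
  shows "d = (2 *\<^sub>R E_vec X) \<oslash>
      (diag ((S_mat X \<odot> S_mat X) ** ones_col ** transpose ones_col ** transpose (S_mat X \<odot> S_mat X))
       + 2 *\<^sub>R diag ((S_mat X \<odot> S_mat X) ** matrix_inv (Q_mat X \<odot> Q_mat X)
                      ** transpose (S_mat X \<odot> S_mat X))
       - E_vec X)
    \<and> (\<forall>j. d $ j = 2 * (V $ j)\<^sup>2 /
      (prob_space.expectation M (\<lambda>\<omega>. (V_hat X (Y \<omega>) $ j)\<^sup>2) - (V $ j)\<^sup>2))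
    \<and> (\<forall>j. V $ j \<noteq> 0 \<and> integrable M (\<lambda>\<omega>. (V_hat X (Y \<omega>) $ j)\<^sup>2)
      \<and> prob_space.expectation M (\<lambda>\<omega>. (V_hat X (Y \<omega>) $ j)\<^sup>2) \<noteq> (V $ j)\<^sup>2)"
proof -
  interpret prob_space M by (rule prob)
  define s where "s = \<sigma>\<^sup>2"
  define t where "t j = (\<Sum>i\<in>UNIV. (S_mat X $ j $ i)\<^sup>2)" for j
  define u where "u j = (\<Sum>k\<in>UNIV. \<Sum>l\<in>UNIV. (vhat_form X j k l)\<^sup>2)" for j
  have s: "s > 0" using sigma_pos by (simp add: s_def)
  have u: "u j > 0" for j
    unfolding u_def by (rule vhat_form_frobenius_pos[OF inv_gram inv_QQ])
  have t: "t j > 0" for j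
  proof -
    obtain i where "S_mat X $ j $ i \<noteq> 0" using S_mat_row_nonzero[OF inv_gram] by blast
    then show ?thesis unfolding t_def by (intro sum_pos2[of _ i]) auto
  qed
  have V: "V $ j = s * t j" for j
    unfolding V_def model s_def t_def
    by (rule ols_variance[OF inv_gram sigma_pos noise_indep noise_normal])
  have form: "V_hat X (Y \<omega>) $ j = quad_form (vhat_form X j) (\<lambda>i. \<epsilon> \<omega> $ i)" for j \<omega>
    unfolding model by (rule V_hat_quad_form[OF inv_gram])
  have int: "integrable M (\<lambda>\<omega>. (V_hat X (Y \<omega>) $ j)\<^sup>2)" for j
    unfolding form by (rule gaussian_quad_form(2)[OF sigma_pos noise_indep noise_normal])
  have second: "expectation (\<lambda>\<omega>. (V_hat X (Y \<omega>) $ j)\<^sup>2) = s\<^sup>2 * ((t j)\<^sup>2 + 2 * u j)" for j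
    unfolding form
    by (subst gaussian_quad_form(3)[OF sigma_pos noise_indep noise_normal])
      (simp_all add: vhat_form_diag[OF inv_QQ] t_def u_def s_def, simp add: vhat_form_def mult_ac)
  have d1: "d $ j = 2 * (V $ j)\<^sup>2 /
      (expectation (\<lambda>\<omega>. (V_hat X (Y \<omega>) $ j)\<^sup>2) - (V $ j)\<^sup>2)" for j
    unfolding d_def dof_def second V using s t[of j] u[of j] by (simp add: field_simps)
  have d2: "d $ j = 2 * (t j)\<^sup>2 / ((t j)\<^sup>2 + 2 * u j - (t j)\<^sup>2)" for j
    unfolding d1 second V using s u[of j] by (simp add: field_simps power_mult_distrib)
  have E: "E_vec X $ j = (t j)\<^sup>2" for j
    unfolding t_def sum_S_mat_squares[OF inv_gram] by (simp add: E_vec_def diag_def power2_eq_square)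
  have T: "diag ((S_mat X \<odot> S_mat X) ** ones_col ** transpose ones_col
      ** transpose (S_mat X \<odot> S_mat X)) $ j = (t j)\<^sup>2" for j
    unfolding diag_ones_col t_def by (simp add: power2_eq_square)
  have U: "diag ((S_mat X \<odot> S_mat X) ** matrix_inv (Q_mat X \<odot> Q_mat X)
      ** transpose (S_mat X \<odot> S_mat X)) $ j = u j" for j
    unfolding u_def by (rule vhat_form_frobenius[OF inv_gram inv_QQ, symmetric])
  show ?thesis
  proof (intro conjI allI)
    show "d = (2 *\<^sub>R E_vec X) \<oslash>
      (diag ((S_mat X \<odot> S_mat X) ** ones_col ** transpose ones_col ** transpose (S_mat X \<odot> S_mat X))
       + 2 *\<^sub>R diag ((S_mat X \<odot> S_mat X) ** matrix_inv (Q_mat X \<odot> Q_mat X)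
                      ** transpose (S_mat X \<odot> S_mat X))
       - E_vec X)"
      by (simp add: vec_eq_iff entrywise_div_def E T U d2)
    show "V $ j \<noteq> 0" for j using s t[of j] by (simp add: V)
    show "expectation (\<lambda>\<omega>. (V_hat X (Y \<omega>) $ j)\<^sup>2) \<noteq> (V $ j)\<^sup>2" for j
      using s u[of j] by (simp add: second V power_mult_distrib)
  qed (rule d1 int)+
qed

end
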